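(* Let $n\ge 1$ and $\vec p=(p_1,\dots,p_n),\vec q=(q_1,\dots,q_n)\in[0,1]^n$. Let $S_{\vec p}$ denote a sum of $n$ independent random variables $X_i\sim\mathrm{Ber}(p_i)$, and similarly $S_{\vec q}$. Define $$\Delta=\sum_{i=1}^n|p_i-q_i|,\qquad \sigma_{\vec p}^2=\sum_{i=1}^n p_i(1-p_i),\qquad \sigma_{\vec q}^2=\sum_{i=1}^n q_i(1-q_i),$$ $$\Phi(\vec p,\vec q)=\min\Big(1,\frac{\Delta}{\sqrt{\sigma_{\vec p}^2+1}}\Big),\qquad \Phi(\vec q,\vec p)=\min\Big(1,\frac{\Delta}{\sqrt{\sigma_{\vec q}^2+1}}\Big).$$ Then $$\mathrm{TV}(S_{\vec p},S_{\vec q})\le C_{\mathrm{BCV}}\,\min\big(\Phi(\vec p,\vec q),\Phi(\vec q,\vec p)\big).$$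
   Context: $\mathrm{TV}$ is the total variation distance between laws on a finite set, $\mathrm{TV}(P,Q)=\frac12\sum_\omega|P(\omega)-Q(\omega)|$; for random variables it means the TV distance of their laws. $\eta_{\mathrm{BCV}}$ is the sharp universal constant of Baillon–Cominetti–Vaisman: the smallest constant such that every finite sum $Z$ of independent Bernoulli random variables with $\mathrm{Var}(Z)>0$ satisfies $\max_k\mathbb P(Z=k)\le \eta_{\mathrm{BCV}}/\sqrt{\mathrm{Var}(Z)}$ (numerically $\eta_{\mathrm{BCV}}\approx0.4688223555$). Set $C_{\mathrm{BCV}}=\sqrt{5/4+\eta_{\mathrm{BCV}}^2}\approx1.2123507747$. *)

theory Defs
  imports "HOL-Probability.Probability"
begin

text \<open>Law of S = X_0 + ... + X_(n-1) with independent X_i ~ Ber(p i).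
  Built as the law of the partial sums, adding an independent Bernoulli at each step.\<close>
fun poibin :: "(nat \<Rightarrow> real) \<Rightarrow> nat \<Rightarrow> nat pmf" where
  "poibin p 0 = return_pmf 0"
| "poibin p (Suc n) =
     bind_pmf (poibin p n) (\<lambda>s. map_pmf (\<lambda>b. s + (if b then 1 else 0)) (bernoulli_pmf (p n)))"

text \<open>Total variation distance between laws with finite support.\<close>
definition tv_pmf :: "'a pmf \<Rightarrow> 'a pmf \<Rightarrow> real" where
  "tv_pmf P Q = (1/2) * (\<Sum>x \<in> set_pmf P \<union> set_pmf Q. \<bar>pmf P x - pmf Q x\<bar>)"

text \<open>Baillon--Cominetti--Vaisman constant: the smallest c such that every finite sum Z
  of independent Bernoullis with Var Z > 0 satisfies max_k P(Z = k) \<le> c / sqrt (Var Z).\<close>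
definition eta_BCV :: real where
  "eta_BCV = Inf {c. \<forall>(m::nat) (r::nat \<Rightarrow> real).
      (\<forall>i<m. 0 \<le> r i \<and> r i \<le> 1) \<longrightarrow>
      measure_pmf.variance (poibin r m) real > 0 \<longrightarrow>
      (\<forall>k. pmf (poibin r m) k \<le> c / sqrt (measure_pmf.variance (poibin r m) real))}"

definition C_BCV :: real where
  "C_BCV = sqrt (5/4 + eta_BCV ^ 2)"

definition Phi :: "nat \<Rightarrow> (nat \<Rightarrow> real) \<Rightarrow> (nat \<Rightarrow> real) \<Rightarrow> real" where
  "Phi n p q = min 1 ((\<Sum>i<n. \<bar>p i - q i\<bar>) / sqrt ((\<Sum>i<n. p i * (1 - p i)) + 1))"

end

theory Submission
  imports Defs
begin

text \<open>Interpolate linearly between the two parameter vectors. Differentiating the law at time \<open>t\<close>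
  moves mass between neighbouring points of the law with coordinate \<open>i\<close> omitted; that law is
  unimodal, so the total variation of its increments is twice its largest atom. By Fourier
  inversion a sum of independent Bernoullis with variance at least \<open>V\<close> has all atoms at most
  \<open>(1/s + 1/s^3) / 2\<close> with \<open>s = sqrt (1 + V)\<close>. By concavity of \<open>x (1 - x)\<close> the omitted law at
  time \<open>t\<close> has variance at least \<open>(1 - t) V\<^sub>i\<close>, where \<open>V\<^sub>i\<close> is \<open>\<sigma>\<^sub>p\<^sup>2\<close> without its \<open>i\<close>-th summand, and
  the integral of the atom bound over \<open>t\<close> is exactly \<open>1 / sqrt (1 + V\<^sub>i)\<close>. Omitting one coordinate
  costs variance at most \<open>1/4\<close>, which gives the constant \<open>sqrt (5/4)\<close>, below \<open>C_BCV\<close> whatever the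
  value of \<open>eta_BCV\<close>.\<close>

section \<open>Generating polynomials of Bernoulli sums and their unimodality\<close>

text \<open>Probability generating function of a sum of independent Bernoullis: its coefficients are
  the point probabilities. Indexing by a set makes omitting a coordinate a set difference.\<close>

definition bern_gf :: "('a \<Rightarrow> real) \<Rightarrow> 'a set \<Rightarrow> real poly" where
  "bern_gf r I = (\<Prod>i\<in>I. [:1 - r i, r i:])"

lemma bern_gf_empty [simp]: "bern_gf r {} = 1"
  by (simp add: bern_gf_def)

lemma bern_gf_insert [simp]:
  "finite I \<Longrightarrow> i \<notin> I \<Longrightarrow> bern_gf r (insert i I) = [:1 - r i, r i:] * bern_gf r I"
  by (simp add: bern_gf_def)

text \<open>\<open>coeff (pCons 0 F) k\<close> plays the role of coefficient \<open>k - 1\<close>,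
  with the value 0 at \<open>k = 0\<close>; recurrences then need no separate boundary case.\<close>

lemma coeff_linear_times:
  fixes a b :: "'a::comm_ring_1"
  shows "coeff ([:a, b:] * F) k = a * coeff F k + b * coeff (pCons 0 F) k"
  by (cases k) simp_all

lemma coeff_bern_gf_nonneg:
  assumes "finite I" "\<And>i. i \<in> I \<Longrightarrow> 0 \<le> r i \<and> r i \<le> 1"
  shows "0 \<le> coeff (bern_gf r I) k"
  using assms
proof (induction I arbitrary: k rule: finite_induct)
  case empty
  then show ?case by (cases k) auto
next
  case (insert i I)
  then show ?case
    by (auto simp: coeff_linear_times coeff_pCons simp del: mult_pCons_left split: nat.split)
qed

definition unimodal_at :: "(nat \<Rightarrow> real) \<Rightarrow> nat \<Rightarrow> bool" where
  "unimodal_at f m \<longleftrightarrow> (\<forall>k<m. f k \<le> f (Suc k)) \<and> (\<forall>k\<ge>m. f (Suc k) \<le> f k)"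

text \<open>Each increment of the product is a convex combination of two consecutive increments of
  \<open>F\<close>, the first of them being the step from 0 to \<open>coeff F 0\<close>. Hence
  increments before \<open>m\<close> are nonnegative and those after \<open>m\<close> nonpositive;
  the sign of the one at \<open>m\<close> decides whether the peak stays at \<open>m\<close> or
  moves to \<open>Suc m\<close>.\<close>

lemma unimodal_at_linear_times:
  fixes F :: "real poly"
  assumes u: "unimodal_at (coeff F) m" and a: "0 \<le> a" "a \<le> 1" and nn: "0 \<le> coeff F 0"
  shows "\<exists>m'. unimodal_at (coeff ([:1 - a, a:] * F)) m'"
proof -
  let ?g = "coeff ([:1 - a, a:] * F)"
  have diff: "?g (Suc k) - ?g k = (1 - a) * (coeff F (Suc k) - coeff F k)
      + a * (coeff F k - coeff (pCons 0 F) k)" for k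
    unfolding coeff_linear_times coeff_pCons_Suc by (simp add: algebra_simps)
  have up: "?g k \<le> ?g (Suc k)" if "k < m" for k
  proof -
    have "coeff (pCons 0 F) k \<le> coeff F k"
      using u nn that by (cases k) (auto simp: unimodal_at_def)
    moreover have "coeff F k \<le> coeff F (Suc k)"
      using u that by (auto simp: unimodal_at_def)
    ultimately have "0 \<le> ?g (Suc k) - ?g k"
      unfolding diff using a by simp
    then show ?thesis by simp
  qed
  have down: "?g (Suc k) \<le> ?g k" if "k > m" for k
  proof -
    have "coeff (pCons 0 F) k \<ge> coeff F k"
      using u that by (cases k) (auto simp: unimodal_at_def)
    moreover have "coeff F k \<ge> coeff F (Suc k)"
      using u that by (auto simp: unimodal_at_def)
    ultimately have "(1 - a) * (coeff F (Suc k) - coeff F k) \<le> 0"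
        "a * (coeff F k - coeff (pCons 0 F) k) \<le> 0"
      using a by (simp_all add: mult_nonneg_nonpos)
    then have "?g (Suc k) - ?g k \<le> 0" unfolding diff by linarith
    then show ?thesis by simp
  qed
  show ?thesis
  proof (cases "?g (Suc m) \<le> ?g m")
    case True
    then have "unimodal_at ?g m"
      unfolding unimodal_at_def using up down by (metis le_neq_implies_less)
    then show ?thesis ..
  next
    case False
    then have "unimodal_at ?g (Suc m)"
      unfolding unimodal_at_def using up down
      by (metis Suc_le_eq less_Suc_eq linorder_not_le nle_le)
    then show ?thesis ..
  qed
qed

lemma unimodal_bern_gf:
  assumes "finite I" "\<And>i. i \<in> I \<Longrightarrow> 0 \<le> r i \<and> r i \<le> 1"
  shows "\<exists>m. unimodal_at (coeff (bern_gf r I)) m"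
  using assms
proof (induction I rule: finite_induct)
  case empty
  show ?case by (rule exI[of _ 0]) (simp add: unimodal_at_def)
next
  case (insert i I)
  then obtain m where "unimodal_at (coeff (bern_gf r I)) m" by auto
  from unimodal_at_linear_times[OF this, of "r i"] insert show ?case
    by (simp add: coeff_bern_gf_nonneg del: mult_pCons_left)
qed

text \<open>The coefficients of \<open>[:-1, 1:] * F\<close> are the negated increments of those of
  \<open>F\<close>. Their absolute values telescope: a climb from 0 to the peak, then a descent that
  stays nonnegative.\<close>

lemma sum_abs_shift_diff_unimodal:
  fixes F :: "real poly"
  assumes u: "unimodal_at (coeff F) m" and nn: "\<And>k. 0 \<le> coeff F k"
  shows "(\<Sum>k\<le>N. \<bar>coeff ([:-1, 1:] * F) k\<bar>) \<le> 2 * coeff F m"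
proof -
  let ?D = "\<lambda>k. coeff ([:-1, 1:] * F) k"
  have D: "?D k = coeff (pCons 0 F) k - coeff F k" for k
    by (simp add: coeff_linear_times del: mult_pCons_left)
  have up: "\<bar>?D k\<bar> = coeff F k - coeff (pCons 0 F) k" if "k \<le> m" for k
  proof -
    have "coeff (pCons 0 F) k \<le> coeff F k"
      using u nn that by (cases k) (auto simp: unimodal_at_def)
    then show ?thesis by (simp add: D del: mult_pCons_left)
  qed
  have down: "\<bar>?D (Suc k)\<bar> = coeff F k - coeff F (Suc k)" if "k \<ge> m" for k
    using u that by (auto simp: unimodal_at_def D simp del: mult_pCons_left)
  have "(\<Sum>k\<le>j. \<bar>?D k\<bar>) = coeff F j" if "j \<le> m" for j
    using that by (induction j) (simp_all add: up del: mult_pCons_left)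
  then have m: "(\<Sum>k\<le>m. \<bar>?D k\<bar>) = coeff F m" by simp
  have tail: "(\<Sum>k\<le>m+j. \<bar>?D k\<bar>) = 2 * coeff F m - coeff F (m + j)" for j
    by (induction j) (simp_all add: m down del: mult_pCons_left)
  \<comment> \<open>Enlarging the range to \<open>m + N\<close> puts the peak inside it, whatever
    \<open>N\<close> is.\<close>
  have "(\<Sum>k\<le>N. \<bar>?D k\<bar>) \<le> (\<Sum>k\<le>m+N. \<bar>?D k\<bar>)"
    by (intro sum_mono2) auto
  also have "\<dots> \<le> 2 * coeff F m"
    unfolding tail using nn by simp
  finally show ?thesis .
qed

section \<open>Derivative along the segment of parameters\<close>

text \<open>The product rule: factor \<open>i\<close> has the constant derivative \<open>d i\<close>
  times \<open>[:-1, 1:]\<close>, and the other factors form the generating polynomial with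
  \<open>i\<close> omitted.\<close>

lemma has_derivative_coeff_bern_gf:
  fixes p d :: "'a \<Rightarrow> real"
  assumes "finite I"
  shows "((\<lambda>t. coeff (bern_gf (\<lambda>i. p i + t * d i) I) k) has_field_derivative
    coeff (\<Sum>i\<in>I. smult (d i) ([:-1, 1:] * bern_gf (\<lambda>i. p i + t * d i) (I - {i}))) k) (at t)"
  using assms
proof (induction I arbitrary: k rule: finite_induct)
  case (insert j I)
  define G where "G t I = bern_gf (\<lambda>i. p i + t * d i) I" for t I
  define E where "E I = (\<Sum>i\<in>I. smult (d i) ([:-1, 1:] * G t (I - {i})))" for I
  let ?a = "p j + t * d j"
  have IH: "((\<lambda>t. coeff (G t I) k) has_field_derivative coeff (E I) k) (at t)" for k
    using insert unfolding G_def E_def by blast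
  have IH': "((\<lambda>t. coeff (pCons 0 (G t I)) k) has_field_derivative coeff (pCons 0 (E I)) k) (at t)" for k
    using IH by (cases k) simp_all
  have G_ins: "G s (insert j J) = [:1 - (p j + s * d j), p j + s * d j:] * G s J"
    if "finite J" "j \<notin> J" for s J
    using that by (simp add: G_def del: mult_pCons_left)
  have "E (insert j I) = smult (d j) ([:-1, 1:] * G t I) +
      (\<Sum>i\<in>I. smult (d i) ([:-1, 1:] * G t (insert j I - {i})))"
    using insert by (simp add: E_def del: mult_pCons_left)
  \<comment> \<open>For \<open>i\<close> in \<open>I\<close> the omitted product still contains the
    factor of \<open>j\<close>, which comes out of the sum and leaves \<open>E I\<close>.\<close>
  also have "(\<Sum>i\<in>I. smult (d i) ([:-1, 1:] * G t (insert j I - {i})))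
      = (\<Sum>i\<in>I. [:1 - ?a, ?a:] * smult (d i) ([:-1, 1:] * G t (I - {i})))"
  proof (rule sum.cong[OF refl])
    fix i assume "i \<in> I"
    then have "insert j I - {i} = insert j (I - {i})" using insert by auto
    then show "smult (d i) ([:-1, 1:] * G t (insert j I - {i})) =
        [:1 - ?a, ?a:] * smult (d i) ([:-1, 1:] * G t (I - {i}))"
      using insert by (simp only: G_ins finite_Diff Diff_iff mult_smult_right mult.left_commute simp_thms)
  qed
  also have "\<dots> = [:1 - ?a, ?a:] * E I"
    unfolding E_def sum_distrib_left ..
  finally have E_ins: "E (insert j I) = smult (d j) ([:-1, 1:] * G t I) + [:1 - ?a, ?a:] * E I" .
  have "((\<lambda>t. coeff (G t (insert j I)) k) has_field_derivative coeff (E (insert j I)) k) (at t)"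
    unfolding E_ins G_ins[OF insert(1,2)] coeff_linear_times coeff_add coeff_smult
    by (rule derivative_eq_intros IH IH' refl)+ (simp add: algebra_simps)
  then show ?case unfolding G_def E_def .
qed simp

section \<open>Fourier bound on the atoms\<close>

lemma integral_inverse_square_cos:
  fixes s :: real
  assumes s: "1 \<le> s"
  shows "((\<lambda>x. 1 / ((s\<^sup>2 + 1) / 2 - (s\<^sup>2 - 1) / 2 * cos x)\<^sup>2) has_integral
           pi * (1 / s + 1 / s ^ 3)) {0..2 * pi}"
proof -
  \<comment> \<open>The usual half-angle primitive jumps at \<open>pi\<close>; \<open>x + 2 arctan (N x / D x)\<close>, built from the
    argument of \<open>1 - c exp (i x)\<close> with \<open>c = (s - 1) / (s + 1)\<close>, is smooth on the whole line.\<close>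
  define A B where "A = (s\<^sup>2 + 1) / 2" and "B = (s\<^sup>2 - 1) / 2"
  define N D where "N x = (s - 1) * sin x" and "D x = (s + 1) - (s - 1) * cos x" for x :: real
  define K where "K x = A - B * cos x" for x :: real
  define T where "T x = (B * (sin x / K x) + A * (x + 2 * arctan (N x / D x)) / s) / s\<^sup>2" for x :: real
  have sq: "sin x ^ 2 = 1 - cos x ^ 2" for x :: real by (simp add: sin_squared_eq)
  have Dpos: "D x > 0" for x
  proof -
    have "(s - 1) * cos x \<le> (s - 1) * 1" by (intro mult_left_mono) (use s in auto)
    then show ?thesis by (simp add: D_def)
  qed
  have Bnn: "0 \<le> B" using s by (simp add: B_def)
  have Kpos: "K x > 0" for x
  proof -
    have "B * cos x \<le> B * 1" by (intro mult_left_mono) (use Bnn in auto)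
    then show ?thesis by (simp add: K_def A_def B_def field_simps)
  qed
  \<comment> \<open>\<open>D x - i N x\<close> equals \<open>(s + 1) - (s - 1) exp (i x)\<close>,
    and this is its squared modulus.\<close>
  have DN: "D x ^ 2 + N x ^ 2 = 4 * K x" for x
    unfolding D_def N_def K_def A_def B_def power_mult_distrib sq
    by (simp add: field_simps power2_eq_square)
  have Dm: "(D has_field_derivative (s - 1) * sin x) (at x)" for x
    unfolding D_def by (auto intro!: derivative_eq_intros)
  have Nm: "(N has_field_derivative (s - 1) * cos x) (at x)" for x
    unfolding N_def by (auto intro!: derivative_eq_intros)
  have Km: "(K has_field_derivative B * sin x) (at x)" for x
    unfolding K_def by (auto intro!: derivative_eq_intros)
  have at: "((\<lambda>x. x + 2 * arctan (N x / D x)) has_field_derivative s / K x) (at x)" for x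
  proof -
    have "((\<lambda>x. N x / D x) has_field_derivative
        ((s - 1) * cos x * D x - N x * ((s - 1) * sin x)) / (D x * D x)) (at x)"
      by (rule DERIV_divide[OF Nm Dm]) (use Dpos[of x] in simp)
    from DERIV_add[OF DERIV_ident DERIV_cmult[OF DERIV_chain2[OF DERIV_arctan this], of 2]]
    have "((\<lambda>x. x + 2 * arctan (N x / D x)) has_field_derivative
        1 + 2 * (inverse (1 + (N x / D x)\<^sup>2) *
          (((s - 1) * cos x * D x - N x * ((s - 1) * sin x)) / (D x * D x)))) (at x)" .
    also have "1 + (N x / D x)\<^sup>2 = 4 * K x / (D x * D x)"
      unfolding DN[symmetric] using Dpos[of x] by (simp add: field_simps power2_eq_square)
    also have "inverse (4 * K x / (D x * D x)) *
          (((s - 1) * cos x * D x - N x * ((s - 1) * sin x)) / (D x * D x))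
        = ((s - 1) * cos x * D x - N x * ((s - 1) * sin x)) / (4 * K x)"
      using Dpos[of x] Kpos[of x] by (simp add: divide_simps)
    also have "(s - 1) * cos x * D x - N x * ((s - 1) * sin x) = 2 * s - 2 * K x"
    proof -
      have "N x * ((s - 1) * sin x) = (s - 1)\<^sup>2 * sin x ^ 2"
        by (simp add: N_def power2_eq_square)
      then show ?thesis
        unfolding sq by (simp add: D_def K_def A_def B_def field_simps power2_eq_square)
    qed
    also have "1 + 2 * ((2 * s - 2 * K x) / (4 * K x)) = s / K x"
      using Kpos[of x] by (simp add: field_simps)
    finally show ?thesis .
  qed
  have AB: "A\<^sup>2 - B\<^sup>2 = s\<^sup>2"
    by (simp add: A_def B_def field_simps power2_eq_square)
  \<comment> \<open>Reduction from the square to the first power: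
    \<open>B (sin / K)' + A / K = (A^2 - B^2) / K^2\<close>, where the numerator is
    \<open>s^2\<close> and \<open>s / K\<close> is the derivative of the arctangent part.\<close>
  have Tm: "(T has_field_derivative 1 / (K x)\<^sup>2) (at x)" for x
  proof -
    have "(T has_field_derivative (B * ((cos x * K x - sin x * (B * sin x)) / (K x * K x))
        + A * (s / K x) / s) / s\<^sup>2) (at x)"
      unfolding T_def
      by (intro DERIV_cdivide[OF DERIV_add[OF DERIV_cmult[OF DERIV_divide[OF DERIV_sin Km]]
            DERIV_cdivide[OF DERIV_cmult[OF at]]]]) (use Kpos[of x] in simp)
    also have "cos x * K x - sin x * (B * sin x) = A * cos x - B"
    proof -
      have "sin x * (B * sin x) = B * sin x ^ 2" by (simp add: power2_eq_square)
      then show ?thesis unfolding sq by (simp add: K_def algebra_simps power2_eq_square)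
    qed
    also have "(B * ((A * cos x - B) / (K x * K x)) + A * (s / K x) / s) / s\<^sup>2
       = (B * (A * cos x - B) + A * K x) / (K x)\<^sup>2 / s\<^sup>2"
      using Kpos[of x] s by (simp add: field_simps power2_eq_square)
    also have "B * (A * cos x - B) + A * K x = s\<^sup>2"
      unfolding AB[symmetric] by (simp add: K_def algebra_simps power2_eq_square)
    also have "s\<^sup>2 / (K x)\<^sup>2 / s\<^sup>2 = 1 / (K x)\<^sup>2" using s by simp
    finally show ?thesis .
  qed
  have "((\<lambda>x. 1 / (K x)\<^sup>2) has_integral (T (2 * pi) - T 0)) {0..2 * pi}"
    by (rule fundamental_theorem_of_calculus)
       (auto simp flip: has_real_derivative_iff_has_vector_derivative
             intro: has_field_derivative_at_within[OF Tm])
  \<comment> \<open>The sine and \<open>N\<close> vanish at both ends, so only the linear term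
    \<open>x\<close> contributes.\<close>
  moreover have "T (2 * pi) - T 0 = pi * (1 / s + 1 / s ^ 3)"
    using s by (simp add: T_def N_def A_def field_simps power2_eq_square power3_eq_cube)
  ultimately show ?thesis by (simp add: K_def A_def B_def)
qed


text \<open>This is the mean over \<open>x\<close> in \<open>[0, 2 pi]\<close> of \<open>1 / (1 + V (1 - cos x) / 2)\<^sup>2\<close>, which majorises
  the bound \<open>exp (- V (1 - cos x))\<close> on the characteristic function.\<close>

definition bern_bound :: "real \<Rightarrow> real" where
  "bern_bound V = (1 / sqrt (1 + V) + 1 / sqrt (1 + V) ^ 3) / 2"

text \<open>Evaluation at \<open>z\<close>, with any truncation \<open>N\<close> that reaches the
  degree. The freedom in \<open>N\<close> serves the induction: the shifted half of the new product
  uses the hypothesis at \<open>N - 1\<close>, the other half at \<open>N\<close>.\<close>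

lemma sum_coeff_bern_gf_power:
  fixes z :: complex
  assumes "finite I" "card I \<le> N"
  shows "(\<Sum>j\<le>N. of_real (coeff (bern_gf r I) j) * z ^ j) = (\<Prod>i\<in>I. of_real (1 - r i) + of_real (r i) * z)"
  using assms
proof (induction I arbitrary: N rule: finite_induct)
  case empty
  have "(\<Sum>j\<le>N. of_real (coeff 1 j) * z ^ j) = (\<Sum>j\<le>N. if j = 0 then 1 else 0)"
    by (rule sum.cong) auto
  then show ?case by simp
next
  case (insert i I)
  then obtain M where N: "N = Suc M" and M: "card I \<le> M"
    by (cases N) auto
  let ?c = "coeff (bern_gf r I)" and ?P = "\<Prod>i\<in>I. of_real (1 - r i) + of_real (r i) * z"
  have "(\<Sum>j\<le>N. of_real (coeff (bern_gf r (insert i I)) j) * z ^ j) =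
     of_real (1 - r i) * (\<Sum>j\<le>N. of_real (?c j) * z ^ j) +
     of_real (r i) * (\<Sum>j\<le>N. of_real (coeff (pCons 0 (bern_gf r I)) j) * z ^ j)"
    unfolding bern_gf_insert[OF insert(1,2)] coeff_linear_times sum_distrib_left sum.distrib[symmetric]
    by (rule sum.cong) (simp_all add: algebra_simps)
  also have "(\<Sum>j\<le>N. of_real (?c j) * z ^ j) = ?P"
    by (rule insert.IH) (use M N in simp)
  also have "(\<Sum>j\<le>N. of_real (coeff (pCons 0 (bern_gf r I)) j) * z ^ j)
      = z * (\<Sum>j\<le>M. of_real (?c j) * z ^ j)"
    unfolding N sum.atMost_Suc_shift by (simp add: sum_distrib_left mult_ac)
  also have "(\<Sum>j\<le>M. of_real (?c j) * z ^ j) = ?P"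
    by (rule insert.IH[OF M])
  finally show ?case using insert by (simp add: algebra_simps)
qed

text \<open>The squared modulus is exactly \<open>1 - 2 r (1 - r) (1 - cos x)\<close>; then apply
  \<open>1 + y \<le> exp y\<close>.\<close>

lemma norm_bernoulli_char_le:
  fixes r x :: real
  shows "norm (of_real (1 - r) + of_real r * cis x) \<le> exp (- (r * (1 - r)) * (1 - cos x))"
proof -
  have "(norm (of_real (1 - r) + of_real r * cis x))\<^sup>2 = (1 - r + r * cos x)\<^sup>2 + r\<^sup>2 * (sin x)\<^sup>2"
    by (simp add: cmod_power2 power_mult_distrib)
  also have "\<dots> = 1 + - (2 * (r * (1 - r)) * (1 - cos x))"
    unfolding sin_squared_eq by (simp add: algebra_simps power2_eq_square)
  also have "\<dots> \<le> exp (- (2 * (r * (1 - r)) * (1 - cos x)))"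
    by (rule exp_ge_add_one_self)
  also have "\<dots> = (exp (- (r * (1 - r)) * (1 - cos x)))\<^sup>2"
    by (simp flip: exp_double)
  finally show ?thesis by (rule power2_le_imp_le) simp
qed

lemma integral_cos_multiple:
  fixes m :: int
  shows "((\<lambda>x. cos (of_int m * x)) has_integral (if m = 0 then 2 * pi else 0)) {0..2 * pi}"
proof (cases "m = 0")
  case True
  then show ?thesis using has_integral_const_real[of "1::real" 0 "2 * pi"] by simp
next
  case False
  have "((\<lambda>x. cos (of_int m * x)) has_integral
      (sin (of_int m * (2 * pi)) / of_int m - sin (of_int m * 0) / of_int m)) {0..2 * pi}"
    by (rule fundamental_theorem_of_calculus)
       (use False in \<open>auto simp flip: has_real_derivative_iff_has_vector_derivative
          intro!: derivative_eq_intros\<close>)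
  moreover have "sin (of_int m * (2 * pi)) = 0"
    using sin_integer_2pi[of "of_int m"] by (simp add: mult.commute)
  ultimately show ?thesis using False by simp
qed

text \<open>Multiplying the characteristic function by \<open>exp (- i k x)\<close> and integrating
  over a period isolates coefficient \<open>k\<close>. Since coefficients are real, the real part
  \<open>f\<close> suffices, and it is at most the modulus.\<close>

lemma coeff_bern_gf_le:
  assumes fin: "finite I" and V: "0 \<le> V" "V \<le> (\<Sum>i\<in>I. r i * (1 - r i))"
  shows "coeff (bern_gf r I) k \<le> bern_bound V"
proof -
  define c where "c = coeff (bern_gf r I)"
  \<comment> \<open>Large enough both to reach the degree and to include the index \<open>k\<close>
    when \<open>k > card I\<close>.\<close>
  define N where "N = card I + k"
  define f where "f x = (\<Sum>j\<le>N. c j * cos (of_int (int j - int k) * x))" for x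
  define s where "s = sqrt (1 + V)"
  have s: "s \<ge> 1" and s2: "s\<^sup>2 = 1 + V" using V by (simp_all add: s_def)
  have int_f: "(f has_integral 2 * pi * c k) {0..2 * pi}"
  proof -
    have "(f has_integral (\<Sum>j\<le>N. c j * (if int j - int k = 0 then 2 * pi else 0))) {0..2 * pi}"
      unfolding f_def by (intro has_integral_sum has_integral_mult_right integral_cos_multiple) auto
    also have "(\<Sum>j\<le>N. c j * (if int j - int k = 0 then 2 * pi else 0)) =
        (\<Sum>j\<le>N. if j = k then 2 * pi * c k else 0)"
      by (rule sum.cong) auto
    also have "\<dots> = 2 * pi * c k" by (simp add: N_def)
    finally show ?thesis .
  qed
  have f_le: "f x \<le> 1 / ((s\<^sup>2 + 1) / 2 - (s\<^sup>2 - 1) / 2 * cos x)\<^sup>2" for x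
  proof -
    have "f x = Re (cis (- (real k * x)) * (\<Sum>j\<le>N. of_real (c j) * cis x ^ j))"
      unfolding f_def sum_distrib_left Re_sum
    proof (rule sum.cong[OF refl])
      fix j
      have "cis (- (real k * x)) * (of_real (c j) * cis x ^ j) =
          of_real (c j) * (cis (- (real k * x)) * cis (real j * x))"
        unfolding Complex.DeMoivre by (rule mult.left_commute)
      also have "cis (- (real k * x)) * cis (real j * x) = cis (of_int (int j - int k) * x)"
        unfolding cis_mult by (rule arg_cong[of _ _ cis]) (simp add: left_diff_distrib)
      finally have eq: "cis (- (real k * x)) * (of_real (c j) * cis x ^ j) =
          of_real (c j) * cis (of_int (int j - int k) * x)" .
      show "c j * cos (of_int (int j - int k) * x) =
          Re (cis (- (real k * x)) * (of_real (c j) * cis x ^ j))"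
        unfolding eq by simp
    qed
    also have "\<dots> \<le> norm (cis (- (real k * x)) * (\<Sum>j\<le>N. of_real (c j) * cis x ^ j))"
      by (rule complex_Re_le_cmod)
    also have "\<dots> = (\<Prod>i\<in>I. norm (of_real (1 - r i) + of_real (r i) * cis x))"
      unfolding c_def using sum_coeff_bern_gf_power[OF fin, of N r "cis x"]
      by (simp add: N_def norm_mult prod_norm)
    also have "\<dots> \<le> (\<Prod>i\<in>I. exp (- (r i * (1 - r i)) * (1 - cos x)))"
      by (intro prod_mono conjI norm_ge_zero norm_bernoulli_char_le)
    also have "\<dots> = exp (- ((\<Sum>i\<in>I. r i * (1 - r i)) * (1 - cos x)))"
      unfolding exp_sum[OF fin, symmetric] by (simp add: sum_negf sum_distrib_right)
    also have "\<dots> \<le> exp (- (V * (1 - cos x)))"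
      using V by (simp add: mult_right_mono)
    \<comment> \<open>Halving the exponent before using \<open>1 + y \<le> exp y\<close> gives a
      sharper majorant than \<open>1 / (1 + V (1 - cos x))\<close>, still with an elementary
      integral.\<close>
    also have "\<dots> = 1 / (exp (V * (1 - cos x) / 2))\<^sup>2"
      by (simp only: exp_minus inverse_eq_divide flip: exp_double) simp
    also have "\<dots> \<le> 1 / (1 + V * (1 - cos x) / 2)\<^sup>2"
    proof -
      have "0 \<le> V * (1 - cos x) / 2" using V by simp
      then show ?thesis
        using exp_ge_add_one_self[of "V * (1 - cos x) / 2"]
        by (intro divide_left_mono power_mono mult_pos_pos zero_less_power) auto
    qed
    also have "1 + V * (1 - cos x) / 2 = (s\<^sup>2 + 1) / 2 - (s\<^sup>2 - 1) / 2 * cos x"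
      unfolding s2 by (simp add: field_simps)
    finally show ?thesis .
  qed
  have "2 * pi * c k \<le> pi * (1 / s + 1 / s ^ 3)"
    by (rule has_integral_le[OF int_f integral_inverse_square_cos[OF s] f_le])
  then show ?thesis by (simp add: c_def bern_bound_def s_def)
qed

section \<open>Integration along the segment\<close>

text \<open>With \<open>u = 1 + (1 - t) V\<close>, the derivative is
  \<open>1 / sqrt u - (u - 1) / (2 u sqrt u)\<close>, which is the atom bound. The primitive
  vanishes at \<open>t = 1\<close>, so it grows by \<open>1 / sqrt (1 + V)\<close> over the unit
  interval.\<close>

lemma has_derivative_bern_bound_primitive:
  assumes "0 \<le> V" "t \<le> 1"
  shows "((\<lambda>t. - (1 - t) / sqrt (1 + (1 - t) * V)) has_field_derivative bern_bound ((1 - t) * V)) (at t)"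
proof -
  define u where "u = 1 + (1 - t) * V"
  have u: "u > 0" using assms by (simp add: u_def add_pos_nonneg)
  have uV: "(1 - t) * V = u - 1" by (simp add: u_def)
  have s: "sqrt u > 0" "sqrt u * sqrt u = u" using u by auto
  have d1: "((\<lambda>t. 1 + (1 - t) * V) has_field_derivative - V) (at t)"
    by (auto intro!: derivative_eq_intros)
  have d2: "((\<lambda>t. sqrt (1 + (1 - t) * V)) has_field_derivative inverse (sqrt u) / 2 * - V) (at t)"
    using DERIV_chain2[OF DERIV_real_sqrt d1] u by (simp add: u_def)
  have d3: "((\<lambda>t. - (1 - t)) has_field_derivative 1) (at t)"
    by (auto intro!: derivative_eq_intros)
  have "((\<lambda>t. - (1 - t) / sqrt (1 + (1 - t) * V)) has_field_derivative
     (1 * sqrt (1 + (1 - t) * V) - - (1 - t) * (inverse (sqrt u) / 2 * - V)) /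
       (sqrt (1 + (1 - t) * V) * sqrt (1 + (1 - t) * V))) (at t)"
    by (rule DERIV_divide[OF d3 d2]) (use u in \<open>simp add: u_def\<close>)
  also have "(1 * sqrt (1 + (1 - t) * V) - - (1 - t) * (inverse (sqrt u) / 2 * - V)) /
       (sqrt (1 + (1 - t) * V) * sqrt (1 + (1 - t) * V)) =
     (sqrt u - (1 - t) * (V * (inverse (sqrt u) / 2))) / (sqrt u * sqrt u)"
  proof -
    have "- (1 - t) * (a * - V) = (1 - t) * (V * a)" for a :: real by (simp add: algebra_simps)
    then show ?thesis unfolding u_def[symmetric] by (simp only: mult_1)
  qed
  also have "(sqrt u - (1 - t) * (V * (inverse (sqrt u) / 2))) / (sqrt u * sqrt u)
      = (sqrt u - (u - 1) * (inverse (sqrt u) / 2)) / (sqrt u * sqrt u)"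
    unfolding uV[symmetric] by simp
  also have "\<dots> = (sqrt u - (sqrt u * sqrt u - 1) * (inverse (sqrt u) / 2)) / (sqrt u * sqrt u)"
    using s by simp
  also have "\<dots> = (1 / sqrt u + 1 / sqrt u ^ 3) / 2"
    using s(1) by (simp only: divide_inverse) (simp add: field_simps power3_eq_cube)
  also have "\<dots> = bern_bound ((1 - t) * V)"
    by (simp add: bern_bound_def u_def)
  finally show ?thesis .
qed

lemma l1_bern_gf_diff_le:
  fixes p q :: "'a \<Rightarrow> real"
  assumes fin: "finite I"
    and p: "\<And>i. i \<in> I \<Longrightarrow> 0 \<le> p i \<and> p i \<le> 1"
    and q: "\<And>i. i \<in> I \<Longrightarrow> 0 \<le> q i \<and> q i \<le> 1"
  shows "(\<Sum>k\<le>N. \<bar>coeff (bern_gf p I) k - coeff (bern_gf q I) k\<bar>)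
    \<le> 2 * (\<Sum>i\<in>I. \<bar>p i - q i\<bar> / sqrt (1 + (\<Sum>j\<in>I-{i}. p j * (1 - p j))))"
proof -
  define d where "d i = q i - p i" for i
  define r where "r t i = p i + t * d i" for t i
  define V where "V i = (\<Sum>j\<in>I-{i}. p j * (1 - p j))" for i
  \<comment> \<open>Signs frozen at the endpoints linearise the distance: \<open>h\<close> is
    differentiable in \<open>t\<close>, yet \<open>h 1 - h 0\<close> is the full sum of absolute
    differences.\<close>
  define e where "e k = sgn (coeff (bern_gf q I) k - coeff (bern_gf p I) k)" for k
  define h where "h t = (\<Sum>k\<le>N. e k * coeff (bern_gf (r t) I) k)" for t
  define H where "H t = 2 * (\<Sum>i\<in>I. \<bar>d i\<bar> * (- (1 - t) / sqrt (1 + (1 - t) * V i)))" for t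
  have V0: "0 \<le> V i" for i unfolding V_def using p by (intro sum_nonneg) auto
  have r01: "0 \<le> r t i \<and> r t i \<le> 1" if "i \<in> I" "0 \<le> t" "t \<le> 1" for i t
  proof -
    have eq: "r t i = (1 - t) * p i + t * q i" by (simp add: r_def d_def algebra_simps)
    have "(1 - t) * p i + t * q i \<le> (1 - t) * 1 + t * 1"
      using p q that by (intro add_mono mult_left_mono) auto
    then show ?thesis unfolding eq using p q that by simp
  qed
  \<comment> \<open>Concavity of \<open>x (1 - x)\<close> in exact form: the excess over the chord
    is \<open>t (1 - t) (p j - q j)^2\<close>. The share of \<open>q j\<close> in the chord is
    dropped.\<close>
  have rV: "(1 - t) * V i \<le> (\<Sum>j\<in>I-{i}. r t j * (1 - r t j))" if t: "0 \<le> t" "t \<le> 1" for i t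
    unfolding V_def sum_distrib_left
  proof (rule sum_mono)
    fix j assume j: "j \<in> I - {i}"
    have "r t j * (1 - r t j) - (1 - t) * (p j * (1 - p j))
        = t * (q j * (1 - q j)) + t * (1 - t) * (p j - q j)\<^sup>2"
      by (simp add: r_def d_def algebra_simps power2_eq_square)
    also have "\<dots> \<ge> 0" using q j t by simp
    finally show "(1 - t) * (p j * (1 - p j)) \<le> r t j * (1 - r t j)" by simp
  qed
  \<comment> \<open>Comparing the derivatives of \<open>h\<close> and \<open>H\<close> takes the
    place of an integral over \<open>t\<close>.\<close>
  have "h 0 - H 0 \<ge> h 1 - H 1"
  proof (rule DERIV_nonpos_imp_nonincreasing[of 0 1 "\<lambda>t. h t - H t"])
    fix t :: real assume t: "0 \<le> t" "t \<le> 1"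
    define G where "G i = [:-1, 1:] * bern_gf (r t) (I - {i})" for i
    define h' where "h' = (\<Sum>k\<le>N. e k * coeff (\<Sum>i\<in>I. smult (d i) (G i)) k)"
    define H' where "H' = 2 * (\<Sum>i\<in>I. \<bar>d i\<bar> * bern_bound ((1 - t) * V i))"
    have "(h has_field_derivative h') (at t)"
      unfolding h_def h'_def G_def r_def
      by (intro DERIV_sum DERIV_cmult has_derivative_coeff_bern_gf fin)
    moreover have "(H has_field_derivative H') (at t)"
      unfolding H_def H'_def
      by (intro DERIV_sum DERIV_cmult has_derivative_bern_bound_primitive V0 t)
    moreover have "h' \<le> H'"
    proof -
      have e: "\<bar>e k\<bar> \<le> 1" for k by (simp add: e_def sgn_if)
      have G: "(\<Sum>k\<le>N. \<bar>coeff (G i) k\<bar>) \<le> 2 * bern_bound ((1 - t) * V i)" for i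
      proof -
        obtain m where m: "unimodal_at (coeff (bern_gf (r t) (I - {i}))) m"
          using unimodal_bern_gf[of "I - {i}" "r t"] fin r01 t by auto
        have "(\<Sum>k\<le>N. \<bar>coeff (G i) k\<bar>) \<le> 2 * coeff (bern_gf (r t) (I - {i})) m"
          unfolding G_def using fin r01 t
          by (intro sum_abs_shift_diff_unimodal[OF m] coeff_bern_gf_nonneg) auto
        also have "coeff (bern_gf (r t) (I - {i})) m \<le> bern_bound ((1 - t) * V i)"
          using fin V0 t rV by (intro coeff_bern_gf_le) auto
        finally show ?thesis by simp
      qed
      \<comment> \<open>Swapping the sums groups the terms by coordinate, so that the variation
        bound \<open>G\<close> applies to each.\<close>
      have "h' = (\<Sum>i\<in>I. d i * (\<Sum>k\<le>N. e k * coeff (G i) k))"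
        unfolding h'_def coeff_sum coeff_smult sum_distrib_left
        by (subst sum.swap) (simp add: mult_ac)
      also have "\<dots> \<le> (\<Sum>i\<in>I. \<bar>d i\<bar> * (2 * bern_bound ((1 - t) * V i)))"
      proof (rule sum_mono)
        fix i
        have "\<bar>\<Sum>k\<le>N. e k * coeff (G i) k\<bar> \<le> (\<Sum>k\<le>N. \<bar>e k * coeff (G i) k\<bar>)"
          by (rule sum_abs)
        also have "\<dots> \<le> (\<Sum>k\<le>N. \<bar>coeff (G i) k\<bar>)"
          unfolding abs_mult using e by (intro sum_mono mult_left_le_one_le) auto
        also have "\<dots> \<le> 2 * bern_bound ((1 - t) * V i)" by (rule G)
        finally have "\<bar>d i * (\<Sum>k\<le>N. e k * coeff (G i) k)\<bar> \<le> \<bar>d i\<bar> * (2 * bern_bound ((1 - t) * V i))"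
          unfolding abs_mult by (intro mult_left_mono) auto
        then show "d i * (\<Sum>k\<le>N. e k * coeff (G i) k) \<le> \<bar>d i\<bar> * (2 * bern_bound ((1 - t) * V i))"
          by linarith
      qed
      also have "\<dots> = H'" by (simp add: H'_def sum_distrib_left mult_ac)
      finally show ?thesis .
    qed
    ultimately show "\<exists>y. ((\<lambda>t. h t - H t) has_field_derivative y) (at t) \<and> y \<le> 0"
      by (intro exI[of _ "h' - H'"] conjI DERIV_diff) auto
  qed simp
  then have "h 1 - h 0 \<le> H 1 - H 0" by simp
  moreover have "h 1 - h 0 = (\<Sum>k\<le>N. \<bar>coeff (bern_gf p I) k - coeff (bern_gf q I) k\<bar>)"
  proof -
    have "r 0 = p" "r 1 = q" by (auto simp: r_def d_def)
    then have "h 1 - h 0 = (\<Sum>k\<le>N. e k * (coeff (bern_gf q I) k - coeff (bern_gf p I) k))"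
      by (simp add: h_def algebra_simps sum_subtractf)
    also have "\<dots> = (\<Sum>k\<le>N. \<bar>coeff (bern_gf p I) k - coeff (bern_gf q I) k\<bar>)"
      by (rule sum.cong) (auto simp: e_def sgn_if)
    finally show ?thesis .
  qed
  moreover have "H 1 - H 0 = 2 * (\<Sum>i\<in>I. \<bar>p i - q i\<bar> / sqrt (1 + V i))"
    by (simp add: H_def d_def sum_negf abs_minus_commute)
  ultimately show ?thesis unfolding V_def[symmetric] by linarith
qed

section \<open>Transfer to laws and total variation\<close>

lemma pmf_poibin:
  assumes "\<And>i. i < n \<Longrightarrow> 0 \<le> p i \<and> p i \<le> 1"
  shows "pmf (poibin p n) k = coeff (bern_gf p {..<n}) k"
  using assms
proof (induction n arbitrary: k)
  case 0
  show ?case by (simp add: pmf_return indicator_def)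
next
  case (Suc n)
  have IH: "pmf (poibin p n) j = coeff (bern_gf p {..<n}) j" for j using Suc by auto
  have shift: "pmf (map_pmf Suc (poibin p n)) k = coeff (pCons 0 (bern_gf p {..<n})) k"
  proof (cases k)
    case 0
    have "0 \<notin> set_pmf (map_pmf Suc (poibin p n))" by auto
    then show ?thesis using 0 by (simp add: pmf_eq_0_set_pmf)
  next
    case (Suc j)
    then show ?thesis by (simp add: pmf_map_inj' IH)
  qed
  \<comment> \<open>Drawing the new Bernoulli first makes the law a two-point mixture of the old law
    and its shift by one, matching multiplication by a linear factor.\<close>
  have eq: "poibin p (Suc n) = bind_pmf (bernoulli_pmf (p n))
      (\<lambda>b. map_pmf (\<lambda>s. s + (if b then 1 else 0)) (poibin p n))"
    unfolding poibin.simps map_pmf_def by (rule bind_commute_pmf)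
  have notin: "n \<notin> {..<n}" by simp
  have "pmf (poibin p (Suc n)) k = p n * pmf (map_pmf Suc (poibin p n)) k + (1 - p n) * pmf (poibin p n) k"
    unfolding eq pmf_bind using Suc.prems[of n] by (simp add: map_pmf_ident)
  also have "\<dots> = coeff (bern_gf p {..<Suc n}) k"
    unfolding lessThan_Suc bern_gf_insert[OF finite_lessThan notin]
    by (simp add: shift IH coeff_linear_times del: mult_pCons_left)
  finally show ?case .
qed

lemma set_poibin: "set_pmf (poibin p n) \<subseteq> {..n}"
proof (induction n)
  case (Suc n)
  then show ?case by (force split: if_splits)
qed simp

lemma tv_poibin_le:
  assumes p: "\<And>i. i < n \<Longrightarrow> 0 \<le> p i \<and> p i \<le> 1"
    and q: "\<And>i. i < n \<Longrightarrow> 0 \<le> q i \<and> q i \<le> 1"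
  shows "tv_pmf (poibin p n) (poibin q n)
    \<le> sqrt (5/4) * ((\<Sum>i<n. \<bar>p i - q i\<bar>) / sqrt ((\<Sum>i<n. p i * (1 - p i)) + 1))"
proof -
  define v where "v = (\<Sum>i<n. p i * (1 - p i))"
  have "tv_pmf (poibin p n) (poibin q n) =
      1/2 * (\<Sum>k\<le>n. \<bar>pmf (poibin p n) k - pmf (poibin q n) k\<bar>)"
    unfolding tv_pmf_def using set_poibin[of p n] set_poibin[of q n]
    by (intro arg_cong[of _ _ "(*) (1/2)"] sum.mono_neutral_left) (auto simp: set_pmf_iff)
  also have "\<dots> = 1/2 * (\<Sum>k\<le>n. \<bar>coeff (bern_gf p {..<n}) k - coeff (bern_gf q {..<n}) k\<bar>)"
    using p q by (simp add: pmf_poibin)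
  also have "\<dots> \<le> (\<Sum>i<n. \<bar>p i - q i\<bar> / sqrt (1 + (\<Sum>j\<in>{..<n}-{i}. p j * (1 - p j))))"
    using l1_bern_gf_diff_le[of "{..<n}" p q n] p q by auto
  also have "\<dots> \<le> (\<Sum>i<n. \<bar>p i - q i\<bar> * (sqrt (5/4) / sqrt (v + 1)))"
  proof (rule sum_mono)
    fix i assume i: "i \<in> {..<n}"
    define W where "W = (\<Sum>j\<in>{..<n}-{i}. p j * (1 - p j))"
    have v: "v = p i * (1 - p i) + W" unfolding v_def W_def using i by (intro sum.remove) auto
    have W: "0 \<le> W" unfolding W_def using p by (intro sum_nonneg) auto
    have a: "0 \<le> p i * (1 - p i)" using p i by auto
    have "p i * (1 - p i) = 1/4 - (p i - 1/2)\<^sup>2" by (simp add: algebra_simps power2_eq_square)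
    also have "\<dots> \<le> 1/4" by simp
    finally have "p i * (1 - p i) \<le> 1/4" .
    \<comment> \<open>Source of the constant:
      \<open>v + 1 \<le> 5/4 + W \<le> 5/4 * (1 + W)\<close>.\<close>
    then have "sqrt (v + 1) \<le> sqrt (5/4 * (1 + W))"
      unfolding v using W by simp
    then have "1 / sqrt (1 + W) \<le> sqrt (5/4) / sqrt (v + 1)"
      unfolding real_sqrt_mult using W a v by (simp add: divide_simps)
    then have "\<bar>p i - q i\<bar> * (1 / sqrt (1 + W)) \<le> \<bar>p i - q i\<bar> * (sqrt (5/4) / sqrt (v + 1))"
      by (rule mult_left_mono) simp
    then show "\<bar>p i - q i\<bar> / sqrt (1 + W) \<le> \<bar>p i - q i\<bar> * (sqrt (5/4) / sqrt (v + 1))" by simp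
  qed
  also have "\<dots> = sqrt (5/4) * ((\<Sum>i<n. \<bar>p i - q i\<bar>) / sqrt (v + 1))"
    by (simp only: sum_distrib_right[symmetric]) simp
  finally show ?thesis by (simp add: v_def)
qed

lemma tv_pmf_commute: "tv_pmf P Q = tv_pmf Q P"
  by (simp add: tv_pmf_def Un_commute abs_minus_commute)

lemma tv_pmf_le_1:
  assumes "finite (set_pmf P)" "finite (set_pmf Q)"
  shows "tv_pmf P Q \<le> 1"
proof -
  let ?S = "set_pmf P \<union> set_pmf Q"
  have "(\<Sum>x\<in>?S. \<bar>pmf P x - pmf Q x\<bar>) \<le> (\<Sum>x\<in>?S. pmf P x + pmf Q x)"
    by (rule sum_mono) (simp add: abs_le_iff add_increasing add_increasing2)
  also have "\<dots> = 2"
    using assms by (simp add: sum.distrib sum_pmf_eq_1)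
  finally show ?thesis by (simp add: tv_pmf_def)
qed

lemma tv_poibin_le_Phi:
  assumes "\<And>i. i < n \<Longrightarrow> 0 \<le> p i \<and> p i \<le> 1"
    and "\<And>i. i < n \<Longrightarrow> 0 \<le> q i \<and> q i \<le> 1"
  shows "tv_pmf (poibin p n) (poibin q n) \<le> sqrt (5/4) * Phi n p q"
proof -
  have "finite (set_pmf (poibin r n))" for r
    using set_poibin[of r n] finite_subset by blast
  then have "tv_pmf (poibin p n) (poibin q n) \<le> 1" by (intro tv_pmf_le_1)
  \<comment> \<open>This covers the case in which the minimum in \<open>Phi\<close> is 1.\<close>
  also have "1 \<le> sqrt (5/4 :: real)" by (simp add: real_le_rsqrt)
  finally show ?thesis
    using tv_poibin_le[OF assms] unfolding Phi_def by (simp add: min_def)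
qed

theorem theorem1:
  fixes n :: nat and p q :: "nat \<Rightarrow> real"
  assumes "n \<ge> 1"
    and "\<And>i. i < n \<Longrightarrow> 0 \<le> p i \<and> p i \<le> 1"
    and "\<And>i. i < n \<Longrightarrow> 0 \<le> q i \<and> q i \<le> 1"
  shows "tv_pmf (poibin p n) (poibin q n) \<le> C_BCV * min (Phi n p q) (Phi n q p)"
proof -
  have nonneg: "0 \<le> Phi n r s" if "\<And>i. i < n \<Longrightarrow> 0 \<le> r i \<and> r i \<le> 1" for r s
    unfolding Phi_def using that by (auto intro!: divide_nonneg_nonneg sum_nonneg add_nonneg_nonneg)
  have "tv_pmf (poibin p n) (poibin q n) \<le> sqrt (5/4) * min (Phi n p q) (Phi n q p)"
  proof -
    have "tv_pmf (poibin p n) (poibin q n) \<le> sqrt (5/4) * Phi n p q"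
      by (rule tv_poibin_le_Phi[OF assms(2,3)])
    moreover have "tv_pmf (poibin p n) (poibin q n) \<le> sqrt (5/4) * Phi n q p"
      unfolding tv_pmf_commute[of "poibin p n"] by (rule tv_poibin_le_Phi[OF assms(3,2)])
    ultimately show ?thesis by (simp add: min_def)
  qed
  \<comment> \<open>The square \<open>eta_BCV ^ 2\<close> under the root can only increase
    it.\<close>
  also have "\<dots> \<le> C_BCV * min (Phi n p q) (Phi n q p)"
    using nonneg assms(2,3) by (intro mult_right_mono) (auto simp: C_BCV_def)
  finally show ?thesis .
qed

end
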